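(* Let $(Q,\ast)$ be a quandle and let $D$ denote the maximal trivial component of $Q$. If $D\neq\emptyset$ and $Q\setminus D\neq\emptyset$, then there is a canonical bijection $$\operatorname{Good}(Q,\ast)\;\cong\;\operatorname{Good}(Q\setminus D,\ast)\times\operatorname{Inv}(D).$$
   Context: A quandle is a set $Q$ with a binary operation $\ast$ such that: (1) $x\ast x=x$ for all $x$; (2) for every $y\in Q$ the map $s_y\colon Q\to Q$, $s_y(x)=x\ast y$, is invertible; (3) $(x\ast y)\ast z=(x\ast z)\ast(y\ast z)$ for all $x,y,z$. Write $x\ast^{-1}y:=s_y^{-1}(x)$. An involution on a set is a self-map $\rho$ with $\rho\circ\rho=\mathrm{id}$ (the identity is allowed); $\operatorname{Inv}(D)$ is the set of all involutions on the set $D$. A good involution on $(Q,\ast)$ is an involution $\rho\colon Q\to Q$ with $\rho(x\ast y)=\rho(x)\ast y$ and $x\ast\rho(y)=x\ast^{-1}y$ for all $x,y\in Q$; $\operatorname{Good}(Q,\ast)$ is the set of good involutions on $(Q,\ast)$. The maximal trivial component of $Q$ is $D=\{x\in Q\mid x\ast y=x \text{ and } y\ast x=y\text{ for all }y\in Q\}$. The complement $Q\setminus D$ is a subquandle of $Q$, with the restricted operation. *)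

theory Defs
  imports Main "HOL-Library.FuncSet"
begin

text \<open>
  A quandle is a carrier set with an operation on the ambient type, of which only the values
  on the carrier matter. The restriction of the operation to a subset is thus the same
  operation paired with a smaller carrier.
\<close>

locale quandle =
  fixes Q :: "'a set" and qop :: "'a \<Rightarrow> 'a \<Rightarrow> 'a" (infixl \<open>\<star>\<close> 70)
  assumes idem: "x \<in> Q \<Longrightarrow> x \<star> x = x"
    and bij_right: "y \<in> Q \<Longrightarrow> bij_betw (\<lambda>x. x \<star> y) Q Q"
    and right_distrib: "\<lbrakk>x \<in> Q; y \<in> Q; z \<in> Q\<rbrakk> \<Longrightarrow> (x \<star> y) \<star> z = (x \<star> z) \<star> (y \<star> z)"

definition quandle_inv :: "'a set \<Rightarrow> ('a \<Rightarrow> 'a \<Rightarrow> 'a) \<Rightarrow> 'a \<Rightarrow> 'a \<Rightarrow> 'a" where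
  "quandle_inv Q qop x y = inv_into Q (\<lambda>z. qop z y) x"

text \<open>
  Self-maps of a set are taken extensional (\<open>undefined\<close> off the set), so that equality
  of elements of \<open>Inv D\<close> is equality of maps on \<open>D\<close>.
\<close>

definition Inv :: "'a set \<Rightarrow> ('a \<Rightarrow> 'a) set" where
  "Inv D = {\<rho> \<in> D \<rightarrow>\<^sub>E D. \<forall>x\<in>D. \<rho> (\<rho> x) = x}"

definition Good :: "'a set \<Rightarrow> ('a \<Rightarrow> 'a \<Rightarrow> 'a) \<Rightarrow> ('a \<Rightarrow> 'a) set" where
  "Good Q qop = {\<rho> \<in> Inv Q. \<forall>x\<in>Q. \<forall>y\<in>Q.
     \<rho> (qop x y) = qop (\<rho> x) y \<and> qop x (\<rho> y) = quandle_inv Q qop x y}"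

definition max_trivial :: "'a set \<Rightarrow> ('a \<Rightarrow> 'a \<Rightarrow> 'a) \<Rightarrow> 'a set" where
  "max_trivial Q qop = {x \<in> Q. \<forall>y\<in>Q. qop x y = x \<and> qop y x = y}"

text \<open>
  The complement of the maximal trivial component is again a quandle, so \<open>Good\<close> may be
  applied to it, and \<open>quandle_inv\<close> is then its genuine inverse operation.
\<close>

lemma (in quandle) quandle_complement: "quandle (Q - max_trivial Q qop) qop"
proof -
  let ?D = "max_trivial Q qop"
  have b: "bij_betw (\<lambda>x. x \<star> y) (Q - ?D) (Q - ?D)" if "y \<in> Q" for y
  proof -
    have "bij_betw (\<lambda>x. x \<star> y) ?D ?D"
      using that by (auto simp: bij_betw_def inj_on_def max_trivial_def image_iff)
    moreover have "?D \<subseteq> Q" by (auto simp: max_trivial_def)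
    ultimately show ?thesis
      using bij_betw_DiffI[OF bij_right[OF that]] by blast
  qed
  show ?thesis
    by unfold_locales (auto simp: idem b right_distrib)
qed

end

theory Submission imports Defs begin

text \<open>
  A good involution \<open>\<rho>\<close> of \<open>Q\<close> maps the maximal trivial component \<open>D\<close> to itself: for
  \<open>x \<in> D\<close> and \<open>y \<in> Q\<close>, the first axiom gives \<open>\<rho> x \<star> y = \<rho> (x \<star> y) = \<rho> x\<close>, and by the
  second \<open>\<rho> x\<close> acts as the inverse of the right translation by \<open>x\<close>, which is the identity.
  Being an involution, \<open>\<rho>\<close> then maps \<open>Q - D\<close> to itself as well, so it is determined by its
  restrictions to these two invariant sets (\<open>good_preserves_max_trivial\<close>).

  Conversely, a good involution \<open>\<sigma>\<close> of \<open>Q - D\<close> and any involution \<open>\<tau>\<close> of \<open>D\<close> glue to a good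
  involution of \<open>Q\<close> (\<open>good_glue\<close>). Whenever one of the two arguments lies in \<open>D\<close>, the
  product is the left argument, and \<open>\<sigma>\<close> and \<open>\<tau>\<close> keep both arguments on their own side;
  hence the axioms impose no condition on \<open>\<tau>\<close> and none linking \<open>\<sigma>\<close> with \<open>\<tau>\<close>.

  The inverse operations of \<open>Q\<close> and of \<open>Q - D\<close> are formally different, since each inverts
  a translation on its own carrier. The equation \<open>(x \<star> \<rho> y) \<star> y = x\<close> expresses the second
  axiom without mentioning the carrier (\<open>good_iff\<close>), which lets the two notions of
  goodness be compared.
\<close>

context quandle
begin

lemma op_closed: "x \<in> Q \<Longrightarrow> y \<in> Q \<Longrightarrow> x \<star> y \<in> Q"
  using bij_right[of y] by (auto simp: bij_betw_def)

lemma eq_quandle_inv_iff: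
  assumes "x \<in> Q" "y \<in> Q" "z \<in> Q"
  shows "z = quandle_inv Q qop x y \<longleftrightarrow> z \<star> y = x"
  unfolding quandle_inv_def
  using bij_betw_inv_into_left[OF bij_right[OF assms(2)] assms(3)]
    bij_betw_inv_into_right[OF bij_right[OF assms(2)] assms(1)]
  by auto

text \<open>
  Translations of \<open>Q\<close> are injective, so a solution of \<open>z \<star> y = x\<close> in \<open>Q\<close> is the value of
  the inverse operation; the second axiom can thus be stated as an equation in \<open>\<star>\<close> alone.
\<close>

lemma good_iff:
  "\<rho> \<in> Good Q qop \<longleftrightarrow>
     \<rho> \<in> Inv Q \<and> (\<forall>x\<in>Q. \<forall>y\<in>Q. \<rho> (x \<star> y) = \<rho> x \<star> y \<and> (x \<star> \<rho> y) \<star> y = x)"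
proof -
  have "x \<star> \<rho> y = quandle_inv Q qop x y \<longleftrightarrow> (x \<star> \<rho> y) \<star> y = x"
    if "\<rho> \<in> Inv Q" "x \<in> Q" "y \<in> Q" for x y
  proof -
    have "\<rho> y \<in> Q"
      using that by (auto simp: Inv_def)
    then show ?thesis
      using eq_quandle_inv_iff[of x y "x \<star> \<rho> y"] op_closed that by blast
  qed
  then show ?thesis
    by (auto simp: Good_def)
qed

text \<open>
  For \<open>x \<in> D\<close>, both axioms reduce to the two triviality conditions on \<open>\<rho> x\<close>, because the
  translation by \<open>x\<close> is the identity and every translation fixes \<open>x\<close>.
\<close>

lemma good_preserves_max_trivial:
  assumes good: "\<rho> \<in> Good Q qop" and x: "x \<in> Q"
  shows "\<rho> x \<in> max_trivial Q qop \<longleftrightarrow> x \<in> max_trivial Q qop"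
proof -
  have inv: "\<rho> u \<in> Q" "\<rho> (\<rho> u) = u" if "u \<in> Q" for u
    using good that by (auto simp: good_iff Inv_def)
  have preserves: "\<rho> u \<in> max_trivial Q qop" if u: "u \<in> max_trivial Q qop" for u
  proof -
    have uQ: "u \<in> Q" and triv: "\<And>y. y \<in> Q \<Longrightarrow> u \<star> y = u \<and> y \<star> u = y"
      using u by (auto simp: max_trivial_def)
    have "\<rho> u \<star> y = \<rho> u" if "y \<in> Q" for y
      using good uQ that triv[OF that] by (metis good_iff)
    moreover have "y \<star> \<rho> u = y" if "y \<in> Q" for y
    proof -
      have "(y \<star> \<rho> u) \<star> u = y"
        using good uQ that by (auto simp: good_iff)
      then show ?thesis
        using triv op_closed inv(1) uQ that by metis
    qed
    ultimately show ?thesis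
      using inv(1)[OF uQ] by (simp add: max_trivial_def)
  qed
  \<comment> \<open>The converse is the same implication applied to \<open>\<rho> x\<close>.\<close>
  show ?thesis
    using preserves[of x] preserves[of "\<rho> x"] inv(2)[OF x] by auto
qed

lemma good_restrict:
  assumes good: "\<rho> \<in> Good Q qop"
  defines "D \<equiv> max_trivial Q qop"
  shows "restrict \<rho> (Q - D) \<in> Good (Q - D) qop" and "restrict \<rho> D \<in> Inv D"
proof -
  interpret C: quandle "Q - D" qop
    unfolding D_def by (rule quandle_complement)
  have DQ: "D \<subseteq> Q"
    by (auto simp: D_def max_trivial_def)
  have ax: "\<rho> x \<in> Q" "\<rho> (\<rho> x) = x" "\<rho> x \<in> D \<longleftrightarrow> x \<in> D" if "x \<in> Q" for x
    using good that good_preserves_max_trivial[OF good that]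
    by (auto simp: good_iff Inv_def D_def)
  show "restrict \<rho> D \<in> Inv D"
    using ax DQ by (auto simp: Inv_def)
  have "restrict \<rho> (Q - D) \<in> Inv (Q - D)"
    using ax by (auto simp: Inv_def)
  moreover have "\<rho> (x \<star> y) = \<rho> x \<star> y \<and> (x \<star> \<rho> y) \<star> y = x" if "x \<in> Q" "y \<in> Q" for x y
    using good that by (auto simp: good_iff)
  ultimately show "restrict \<rho> (Q - D) \<in> Good (Q - D) qop"
    using C.op_closed by (simp add: C.good_iff)
qed

text \<open>
  When both arguments lie in \<open>Q - D\<close>, the axioms are those of \<open>\<sigma>\<close>. Otherwise every product
  occurring in them equals its left argument, and both axioms become identities.
\<close>

lemma good_glue:
  defines "D \<equiv> max_trivial Q qop"
  assumes \<sigma>: "\<sigma> \<in> Good (Q - D) qop" and \<tau>: "\<tau> \<in> Inv D"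
  shows "(\<lambda>x. if x \<in> D then \<tau> x else \<sigma> x) \<in> Good Q qop" (is "?\<rho> \<in> _")
proof -
  interpret C: quandle "Q - D" qop
    unfolding D_def by (rule quandle_complement)
  have DQ: "D \<subseteq> Q"
    by (auto simp: D_def max_trivial_def)
  have triv: "u \<star> v = u" if "u \<in> Q" "v \<in> Q" "u \<in> D \<or> v \<in> D" for u v
    using that by (auto simp: D_def max_trivial_def)
  have \<tau>D: "\<tau> x \<in> D" "\<tau> (\<tau> x) = x" if "x \<in> D" for x
    using \<tau> that by (auto simp: Inv_def)
  have \<sigma>inv: "\<sigma> \<in> (Q - D) \<rightarrow>\<^sub>E (Q - D)" "\<And>x. x \<in> Q - D \<Longrightarrow> \<sigma> (\<sigma> x) = x"
    using \<sigma> by (auto simp: C.good_iff Inv_def)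
  have \<sigma>C: "\<sigma> x \<in> Q - D" if "x \<in> Q - D" for x
    using \<sigma>inv(1) that by (rule PiE_mem)
  have \<rho>D: "?\<rho> x \<in> Q" "?\<rho> x \<in> D \<longleftrightarrow> x \<in> D" "?\<rho> (?\<rho> x) = x" if "x \<in> Q" for x
    using that \<tau>D[of x] \<sigma>C[of x] \<sigma>inv(2)[of x] DQ by auto
  have "?\<rho> x = undefined" if "x \<notin> Q" for x
    using that DQ \<sigma>inv(1) by (auto intro: PiE_arb)
  with \<rho>D have inv: "?\<rho> \<in> Inv Q"
    unfolding Inv_def by blast
  have axioms: "?\<rho> (x \<star> y) = ?\<rho> x \<star> y \<and> (x \<star> ?\<rho> y) \<star> y = x" if x: "x \<in> Q" and y: "y \<in> Q" for x y
  proof (cases "x \<in> D \<or> y \<in> D")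
    case True
    have "x \<star> y = x" "?\<rho> x \<star> y = ?\<rho> x" "x \<star> ?\<rho> y = x"
      using triv \<rho>D x y True by blast+
    then show ?thesis
      by metis
  next
    case False
    then show ?thesis
      using \<sigma> C.op_closed[of x y] x y by (auto simp: C.good_iff)
  qed
  show ?thesis
    unfolding good_iff by (intro conjI ballI inv axioms[THEN conjunct1] axioms[THEN conjunct2])
qed

end

theorem theorem1p1:
  fixes Q :: "'a set" and qop :: "'a \<Rightarrow> 'a \<Rightarrow> 'a" and D :: "'a set"
  assumes "quandle Q qop"
    and "D = max_trivial Q qop"
    and "D \<noteq> {}"
    and "Q - D \<noteq> {}"
  shows "bij_betw (\<lambda>\<rho>. (restrict \<rho> (Q - D), restrict \<rho> D))
           (Good Q qop) (Good (Q - D) qop \<times> Inv D)"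
proof -
  interpret quandle Q qop
    by (rule assms(1))
  define glue where "glue = (\<lambda>(\<sigma>, \<tau>) x. if x \<in> D then \<tau> x else (\<sigma> x :: 'a))"
  show ?thesis
  proof (rule bij_betw_byWitness[where f' = glue])
    show "\<forall>\<rho>\<in>Good Q qop. glue (restrict \<rho> (Q - D), restrict \<rho> D) = \<rho>"
    proof
      fix \<rho> assume "\<rho> \<in> Good Q qop"
      then have "\<rho> \<in> extensional Q"
        unfolding Good_def Inv_def PiE_def by blast
      \<comment> \<open>Off \<open>Q\<close>, the glued map takes the value \<open>undefined\<close> of an extensional map, as \<open>\<rho>\<close> does.\<close>
      then show "glue (restrict \<rho> (Q - D), restrict \<rho> D) = \<rho>"
        unfolding glue_def by (intro ext) (auto simp: extensional_def)
    qed
    show "\<forall>p\<in>Good (Q - D) qop \<times> Inv D. (restrict (glue p) (Q - D), restrict (glue p) D) = p"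
    proof
      fix p assume p: "p \<in> Good (Q - D) qop \<times> Inv D"
      obtain \<sigma> \<tau> where eq: "p = (\<sigma>, \<tau>)"
        by (cases p)
      have "\<sigma> \<in> extensional (Q - D)" "\<tau> \<in> extensional D"
        using p unfolding eq Good_def Inv_def PiE_def by blast+
      then have "restrict (glue p) (Q - D) = \<sigma>" "restrict (glue p) D = \<tau>"
        unfolding eq glue_def by (intro ext; auto simp: extensional_def)+
      then show "(restrict (glue p) (Q - D), restrict (glue p) D) = p"
        by (simp add: eq)
    qed
    show "(\<lambda>\<rho>. (restrict \<rho> (Q - D), restrict \<rho> D)) ` Good Q qop \<subseteq> Good (Q - D) qop \<times> Inv D"
      using good_restrict unfolding assms(2) by blast
    show "glue ` (Good (Q - D) qop \<times> Inv D) \<subseteq> Good Q qop"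
      using good_glue unfolding assms(2) glue_def by auto
  qed
qed

end
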